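(* Let $G$ be a $k$-regular non-bipartite distance-regular graph with odd girth $g=2h+1$. Then $$\delta(G)\ \ge\ \Bigl(1-\cos\bigl(\tfrac{\pi}{2h+1}\bigr)\Bigr)\,k\ >\ \biggl(\frac{\pi^2}{2(2h+1)^2}-\frac{\pi^4}{24(2h+1)^4}\biggr)\,k .$$
   Context: Graphs are finite and simple, and distance-regular graphs are connected. The odd girth of a non-bipartite graph is the length of its shortest odd cycle. The eigenvalues of a graph $G$ are those of its adjacency matrix; $\lambda_1(G)$ denotes the largest and $\lambda_{\min}(G)$ the smallest eigenvalue, and $\delta(G)=\lambda_{\min}(G)+\lambda_1(G)$. (If $G$ is $k$-regular, then $\lambda_1(G)=k$ and $\delta(G)=\lambda_{\min}(G)+k$.) *)

theory Defs
  imports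
    "Graph_Theory.Graph_Theory"
    "Jordan_Normal_Form.Spectral_Radius"
begin

text \<open>
  Finite simple graphs are the symmetric, loop-free digraphs without multiple arcs of the
  locale \<^locale>\<open>graph\<close>: an undirected edge is a pair of mutually inverse arcs.
\<close>

definition bipartite :: "('a, 'b) pre_digraph \<Rightarrow> bool" where
  "bipartite G \<longleftrightarrow> (\<exists>X Y. verts G = X \<union> Y \<and> X \<inter> Y = {} \<and>
     (\<forall>u v. u \<rightarrow>\<^bsub>G\<^esub> v \<longrightarrow> (u \<in> X \<and> v \<in> Y) \<or> (u \<in> Y \<and> v \<in> X)))"

definition regular_graph :: "('a, 'b) pre_digraph \<Rightarrow> nat \<Rightarrow> bool" where
  "regular_graph G k \<longleftrightarrow> (\<forall>v \<in> verts G. out_degree G v = k)"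

text \<open>
  In a symmetric digraph traversing an edge back and forth is a directed cycle of length 2;
  being even, it is irrelevant here. Odd directed cycles of a loop-free symmetric digraph have
  length at least 3 and are exactly the oriented odd cycles of the undirected graph.
  The value is meaningful only if there is an odd cycle, i.e. for non-bipartite graphs.
\<close>

definition odd_girth :: "('a, 'b) pre_digraph \<Rightarrow> nat" where
  "odd_girth G = (LEAST n. odd n \<and> (\<exists>p. pre_digraph.cycle G p \<and> length p = n))"

definition graph_dist :: "('a, 'b) pre_digraph \<Rightarrow> 'a \<Rightarrow> 'a \<Rightarrow> ereal" where
  "graph_dist G u v = wf_digraph.\<mu> G (\<lambda>_. 1) u v"

text \<open>
  The numbers \<open>b i\<close> and \<open>c i\<close> form the intersection array. The index \<open>i - 1\<close> is taken in the
  reals, so that for \<open>i = 0\<close> the second set is empty.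
\<close>

definition distance_regular :: "('a, 'b) pre_digraph \<Rightarrow> bool" where
  "distance_regular G \<longleftrightarrow> Digraph_Component.connected G \<and>
     (\<exists>b c :: nat \<Rightarrow> nat. \<forall>i. \<forall>u \<in> verts G. \<forall>v \<in> verts G.
        graph_dist G u v = ereal (real i) \<longrightarrow>
          card {w \<in> verts G. v \<rightarrow>\<^bsub>G\<^esub> w \<and> graph_dist G u w = ereal (real i + 1)} = b i \<and>
          card {w \<in> verts G. v \<rightarrow>\<^bsub>G\<^esub> w \<and> graph_dist G u w = ereal (real i - 1)} = c i)"

definition adjacency_matrix :: "('a, 'b) pre_digraph \<Rightarrow> 'a list \<Rightarrow> real mat" where
  "adjacency_matrix G vs =
     Matrix.mat (length vs) (length vs) (\<lambda>(i, j). if vs ! i \<rightarrow>\<^bsub>G\<^esub> vs ! j then 1 else 0)"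

text \<open>
  The adjacency matrix depends on an enumeration of the vertices, its eigenvalues do not
  (see \<open>graph_eigenvalues_eq_spectrum\<close>). As the matrix is symmetric, all its eigenvalues are real,
  so that working over the reals loses nothing.
\<close>

definition graph_eigenvalues :: "('a, 'b) pre_digraph \<Rightarrow> real set" where
  "graph_eigenvalues G =
     {x. \<exists>vs. distinct vs \<and> set vs = verts G \<and> eigenvalue (adjacency_matrix G vs) x}"

definition lambda_max :: "('a, 'b) pre_digraph \<Rightarrow> real" where
  "lambda_max G = Max (graph_eigenvalues G)"

definition lambda_min :: "('a, 'b) pre_digraph \<Rightarrow> real" where
  "lambda_min G = Min (graph_eigenvalues G)"

definition graph_delta :: "('a, 'b) pre_digraph \<Rightarrow> real" where
  "graph_delta G = lambda_min G + lambda_max G"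

lemma eigenvalue_adjacency_matrix_iff:
  assumes vs: "distinct vs" "set vs = V"
  shows "eigenvalue (adjacency_matrix G vs) x \<longleftrightarrow>
    (\<exists>f. (\<exists>v\<in>V. f v \<noteq> 0) \<and> (\<forall>v\<in>V. (\<Sum>w\<in>V. if v \<rightarrow>\<^bsub>G\<^esub> w then f w else 0) = x * f v))"
    (is "_ \<longleftrightarrow> ?R")
proof -
  let ?n = "length vs" and ?A = "adjacency_matrix G vs"
  have sum_vs: "(\<Sum>w\<in>V. g w) = (\<Sum>j<?n. g (vs ! j))" for g :: "'a \<Rightarrow> real"
    using sum.reindex_bij_betw[OF bij_betw_nth[OF vs(1), of "{..<?n}" V], of g] vs(2) by simp
  have row: "(?A *\<^sub>v y) $ i = (\<Sum>j<?n. if vs ! i \<rightarrow>\<^bsub>G\<^esub> vs ! j then y $ j else 0)"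
    if "y \<in> carrier_vec ?n" "i < ?n" for y i
    using that
    by (auto simp: adjacency_matrix_def scalar_prod_def atLeast0LessThan intro!: sum.cong)
  have dim: "dim_row ?A = ?n" by (simp add: adjacency_matrix_def)
  show ?thesis
  proof
    assume "eigenvalue ?A x"
    then obtain y where y: "y \<in> carrier_vec ?n" "y \<noteq> 0\<^sub>v ?n" "?A *\<^sub>v y = x \<cdot>\<^sub>v y"
      by (auto simp: eigenvalue_def eigenvector_def dim)
    define f where "f v = y $ (THE i. i < ?n \<and> vs ! i = v)" for v
    have f: "f (vs ! i) = y $ i" if "i < ?n" for i
    proof -
      have "(THE j. j < ?n \<and> vs ! j = vs ! i) = i"
        using that vs(1) by (intro the_equality) (auto simp: nth_eq_iff_index_eq)
      then show ?thesis by (simp add: f_def)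
    qed
    obtain i where i: "i < ?n" "y $ i \<noteq> 0"
    proof (rule ccontr)
      assume "\<not> thesis"
      then have "y = 0\<^sub>v ?n" using y(1) that by (intro eq_vecI) auto
      with y(2) show False ..
    qed
    have "(\<Sum>w\<in>V. if v \<rightarrow>\<^bsub>G\<^esub> w then f w else 0) = x * f v" if v: "v \<in> V" for v
    proof -
      obtain l where l: "l < ?n" "v = vs ! l"
        using v vs(2) by (metis in_set_conv_nth)
      have "(\<Sum>w\<in>V. if v \<rightarrow>\<^bsub>G\<^esub> w then f w else 0) = (?A *\<^sub>v y) $ l"
        unfolding sum_vs row[OF y(1) l(1)] l(2) by (intro sum.cong) (auto simp: f)
      also have "\<dots> = x * f v" using y(1) l f by (simp add: y(3))
      finally show ?thesis .
    qed
    moreover have "vs ! i \<in> V" "f (vs ! i) \<noteq> 0" using i f vs(2) by auto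
    ultimately show ?R by blast
  next
    assume ?R
    then obtain f v where f: "v \<in> V" "f v \<noteq> 0"
      "\<And>v. v \<in> V \<Longrightarrow> (\<Sum>w\<in>V. if v \<rightarrow>\<^bsub>G\<^esub> w then f w else 0) = x * f v" by blast
    define y where "y = Matrix.vec ?n (\<lambda>i. f (vs ! i))"
    obtain l where l: "l < ?n" "v = vs ! l"
      using f(1) vs(2) by (metis in_set_conv_nth)
    have y: "y \<in> carrier_vec ?n" by (simp add: y_def)
    have "y $ l \<noteq> 0" using l f(2) by (simp add: y_def)
    then have "y \<noteq> 0\<^sub>v ?n" using l(1) by auto
    moreover have "?A *\<^sub>v y = x \<cdot>\<^sub>v y"
    proof (rule eq_vecI)
      fix i assume "i < dim_vec (x \<cdot>\<^sub>v y)"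
      then have i: "i < ?n" by (simp add: y_def)
      then have "vs ! i \<in> V" using vs(2) by auto
      have "(?A *\<^sub>v y) $ i = (\<Sum>w\<in>V. if vs ! i \<rightarrow>\<^bsub>G\<^esub> w then f w else 0)"
        unfolding sum_vs row[OF y i] by (intro sum.cong) (auto simp: y_def)
      also have "\<dots> = (x \<cdot>\<^sub>v y) $ i" using f(3)[OF \<open>vs ! i \<in> V\<close>] i by (simp add: y_def)
      finally show "(?A *\<^sub>v y) $ i = (x \<cdot>\<^sub>v y) $ i" .
    qed (simp add: dim y_def)
    ultimately show "eigenvalue ?A x"
      using y by (auto simp: eigenvalue_def eigenvector_def dim)
  qed
qed

lemma graph_eigenvalues_eq_spectrum:
  assumes "distinct vs" "set vs = verts G"
  shows "graph_eigenvalues G = spectrum (adjacency_matrix G vs)"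
  using assms eigenvalue_adjacency_matrix_iff[of _ "verts G" G]
  by (auto simp: graph_eigenvalues_def spectrum_def)

end

(*
  Let A be the adjacency matrix and g the odd girth. By distance-regularity the entries of
  (r I - A)^(2 n) depend only on the distance of the two vertices: alpha on the diagonal and beta on
  edges. This matrix is the Gram matrix of the rows of (r I - A)^n, so the rows of adjacent vertices
  all meet at the same angle. Negating every second row along a closed walk of length g leads from a
  vector to its negative, so by the spherical triangle inequality beta >= - cos (pi / g) alpha. Hence
  the diagonal entry grows at most by the factor r^2 + 2 r k cos (pi / g) + k^2 from n to n + 1, while
  an eigenvalue theta forces growth by (r - theta)^2. Letting r grow yields theta >= - k cos (pi / g).
*)

theory Submission
  imports Defs "HOL-Analysis.Convex"
begin

section \<open>Distances and odd cycles\<close>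

text \<open>A natural-number counterpart of \<open>graph_dist\<close>, suited to parity arguments
  and to indexing sequences; it is meaningful where a walk exists.\<close>

definition hop_dist :: "('a, 'b) pre_digraph \<Rightarrow> 'a \<Rightarrow> 'a \<Rightarrow> nat" where
  "hop_dist G u v = (LEAST n. \<exists>p. pre_digraph.awalk G u p v \<and> length p = n)"

definition nbrs :: "('a, 'b) pre_digraph \<Rightarrow> 'a \<Rightarrow> 'a set" where
  "nbrs G v = {w \<in> verts G. v \<rightarrow>\<^bsub>G\<^esub> w}"

text \<open>A repeated vertex splits a closed walk into two shorter closed walks whose lengths add
  up to the original one, so one of them is again odd.\<close>

lemma (in wf_digraph) odd_closed_walk_imp_odd_cycle:
  assumes "awalk u p u" "odd (length p)"
  shows "\<exists>p. cycle p \<and> odd (length p)"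
  using assms
proof (induction "length p" arbitrary: u p rule: less_induct)
  case less
  show ?case
  proof (cases "distinct (tl (awalk_verts u p))")
    case True
    with less.prems show ?thesis unfolding cycle_def by (metis even_zero list.size(3))
  next
    case False
    \<comment> \<open>The repetition is among the vertices after the starting one, hence inside
      \<open>es\<close>; keeping \<open>e\<close> apart makes the excised loop \<open>r\<close>
      strictly shorter than \<open>p\<close>.\<close>
    from less.prems obtain e es where p: "p = e # es" by (cases p) auto
    with False less.prems have es: "awalk (head G e) es u" "\<not> distinct (awalk_verts (head G e) es)"
      and e: "e \<in> arcs G" "u = tail G e"
      by (auto simp: awalk_Cons_iff)
    obtain q r s w where qrs: "es = q @ r @ s" "0 < length r"
      "awalk (head G e) q w" "awalk w r w" "awalk w s u"
      using awalk_not_distinct_decomp[OF es] by blast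
    show ?thesis
    proof (cases "odd (length r)")
      case True
      then show ?thesis using less.hyps[OF _ qrs(4)] p qrs(1) by simp
    next
      case False
      have "awalk u (e # q @ s) u"
        using awalk_appendI[OF qrs(3,5)] e by (simp add: awalk_Cons_iff)
      moreover have "odd (length (e # q @ s))"
        using less.prems(2) False p qrs(1) by simp
      moreover have "length (e # q @ s) < length p" using p qrs(1,2) by simp
      ultimately show ?thesis using less.hyps by blast
    qed
  qed
qed

lemma (in wf_digraph) adj_awalk:
  assumes "u \<rightarrow>\<^bsub>G\<^esub> v" shows "\<exists>e. awalk u [e] v"
  using assms by (auto simp: arcs_ends_conv awalk_simps)

lemma (in sym_digraph) adj_sym: "u \<rightarrow>\<^bsub>G\<^esub> v \<Longrightarrow> v \<rightarrow>\<^bsub>G\<^esub> u"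
  using sym_arcs by (simp add: symmetric_def symD)

lemma (in sym_digraph) awalk_rev:
  assumes "awalk u p v" shows "\<exists>q. awalk v q u \<and> length q = length p"
  using assms
proof (induction p arbitrary: u)
  case Nil
  then show ?case by (auto simp: awalk_Nil_iff)
next
  case (Cons e p)
  then have e: "e \<in> arcs G" "u = tail G e" and "awalk (head G e) p v"
    by (auto simp: awalk_Cons_iff)
  with Cons.IH obtain q where q: "awalk v q (head G e)" "length q = length p" by blast
  obtain a where "awalk (head G e) [a] u"
    using adj_awalk adj_sym in_arcs_imp_in_arcs_ends e by blast
  then have "awalk v (q @ [a]) u" using q(1) awalk_appendI by blast
  then show ?case using q(2) by (intro exI[of _ "q @ [a]"]) simp
qed

lemma (in wf_digraph) awalk_cost_unit: "awalk_cost (\<lambda>_. 1) p = real (length p)"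
  by (induction p) auto

section \<open>Walk-length distance in connected graphs\<close>

locale connected_graph = graph +
  assumes connected_G: "Digraph_Component.connected G"
begin

lemma ex_awalk:
  assumes "u \<in> verts G" "v \<in> verts G" shows "\<exists>p. awalk u p v"
proof -
  have "u \<rightarrow>\<^sup>*\<^bsub>mk_symmetric G\<^esub> v"
    using connected_G assms by (auto simp: Digraph_Component.connected_def strongly_connected_def)
  then show ?thesis
    using reachable_mk_symmetric_eq[OF sym_arcs] reachable_awalk by auto
qed

lemma hop_dist_le: "awalk u p v \<Longrightarrow> hop_dist G u v \<le> length p"
  unfolding hop_dist_def by (rule Least_le) blast

lemma hop_dist_awalk:
  assumes "u \<in> verts G" "v \<in> verts G"
  shows "\<exists>p. awalk u p v \<and> length p = hop_dist G u v"
  unfolding hop_dist_def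
  using ex_awalk[OF assms] LeastI_ex[of "\<lambda>n. \<exists>p. awalk u p v \<and> length p = n"] by simp

lemma graph_dist_eq_hop_dist:
  assumes "u \<in> verts G" "v \<in> verts G"
  shows "graph_dist G u v = ereal (real (hop_dist G u v))"
proof -
  obtain p where "awalk u p v" "length p = hop_dist G u v"
    using hop_dist_awalk[OF assms] by blast
  then show ?thesis
    unfolding graph_dist_def \<mu>_def awalk_cost_unit
    by (intro antisym INF_greatest INF_lower2[of p]) (auto simp: hop_dist_le)
qed

lemma hop_dist_commute:
  assumes "u \<in> verts G" "v \<in> verts G"
  shows "hop_dist G u v = hop_dist G v u"
  using assms hop_dist_awalk awalk_rev hop_dist_le by (metis antisym)

lemma hop_dist_self: "u \<in> verts G \<Longrightarrow> hop_dist G u u = 0"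
  using hop_dist_le[of u "[]" u] by (simp add: awalk_Nil_iff)

lemma hop_dist_adj:
  assumes "u \<rightarrow>\<^bsub>G\<^esub> v" shows "hop_dist G u v = 1"
proof -
  have uv: "u \<in> verts G" "v \<in> verts G" using adj_in_verts[OF assms] by auto
  obtain p where p: "awalk u p v" "length p = hop_dist G u v"
    using hop_dist_awalk[OF uv] by blast
  have "p \<noteq> []" using p(1) adj_not_same assms by (auto simp: awalk_Nil_iff)
  moreover obtain e where "awalk u [e] v" using adj_awalk[OF assms] by blast
  then have "hop_dist G u v \<le> 1" using hop_dist_le[of u "[e]" v] by simp
  ultimately show ?thesis using p(2) by (cases p) auto
qed

lemma hop_dist_step:
  assumes "u \<in> verts G" "v \<rightarrow>\<^bsub>G\<^esub> w"
  shows "hop_dist G u w \<le> hop_dist G u v + 1"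
proof -
  obtain p where "awalk u p v" "length p = hop_dist G u v"
    using hop_dist_awalk adj_in_verts assms by blast
  moreover obtain e where "awalk v [e] w" using adj_awalk[OF assms(2)] by blast
  ultimately show ?thesis
    using hop_dist_le[OF awalk_appendI[of u p v "[e]" w]] by simp
qed

lemma hop_dist_nbr_cases:
  assumes "u \<in> verts G" "v \<rightarrow>\<^bsub>G\<^esub> w"
  shows "hop_dist G u w = hop_dist G u v + 1 \<or> hop_dist G u w = hop_dist G u v
    \<or> hop_dist G u v = hop_dist G u w + 1"
  using hop_dist_step[OF assms] hop_dist_step[OF assms(1) adj_sym[OF assms(2)]] by linarith

text \<open>
  Colouring by the parity of the distance from a root fails on some edge; together with shortest
  walks to the root this edge gives a closed walk of odd length.
\<close>
lemma not_bipartite_imp_odd_cycle: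
  assumes "\<not> bipartite G"
  shows "\<exists>p. cycle p \<and> odd (length p)"
proof -
  obtain u where u: "u \<in> verts G"
    using connected_G by (auto simp: Digraph_Component.connected_def strongly_connected_def)
  define X where "X = {v \<in> verts G. even (hop_dist G u v)}"
  obtain v w where vw: "v \<rightarrow>\<^bsub>G\<^esub> w"
    and nb: "\<not> (v \<in> X \<and> w \<in> verts G - X)" "\<not> (v \<in> verts G - X \<and> w \<in> X)"
  proof -
    have "verts G = X \<union> (verts G - X)" "X \<inter> (verts G - X) = {}" by (auto simp: X_def)
    then show ?thesis using assms that unfolding bipartite_def by blast
  qed
  have V: "v \<in> verts G" "w \<in> verts G" using adj_in_verts[OF vw] by auto
  have par: "even (hop_dist G u v) \<longleftrightarrow> even (hop_dist G w u)"
    using nb V hop_dist_commute[OF u V(2)] by (auto simp: X_def)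
  obtain p e q where "awalk u p v" "length p = hop_dist G u v" "awalk v [e] w"
    "awalk w q u" "length q = hop_dist G w u"
    using hop_dist_awalk u V adj_awalk[OF vw] by metis
  then have "awalk u (p @ [e] @ q) u" "odd (length (p @ [e] @ q))"
    using par awalk_appendI by (blast, simp)
  then show ?thesis by (rule odd_closed_walk_imp_odd_cycle)
qed

end

section \<open>Unit vectors around an odd closed walk\<close>

text \<open>Spherical triangle inequality: Cauchy-Schwarz is applied to the components of
  \<open>a\<close> and \<open>c\<close> orthogonal to \<open>b\<close>. The angle from
  \<open>b\<close> to \<open>c\<close> is only bounded above by \<open>t\<close>, because that is
  what the induction along a walk supplies.\<close>

lemma cos_add_le_inner:
  fixes a b c :: "'i \<Rightarrow> real"
  assumes "(\<Sum>i\<in>I. (a i)\<^sup>2) = 1" "(\<Sum>i\<in>I. (b i)\<^sup>2) = 1" "(\<Sum>i\<in>I. (c i)\<^sup>2) = 1"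
    and ab: "(\<Sum>i\<in>I. a i * b i) = cos s" and bc: "cos t \<le> (\<Sum>i\<in>I. b i * c i)"
    and st: "0 \<le> s" "0 \<le> t" "s + t \<le> pi"
  shows "cos (s + t) \<le> (\<Sum>i\<in>I. a i * c i)"
proof -
  define y where "y = (\<Sum>i\<in>I. b i * c i)"
  define z where "z = (\<Sum>i\<in>I. a i * c i)"
  have "y\<^sup>2 \<le> 1"
    using Cauchy_Schwarz_ineq_sum[of b c I] assms by (simp add: y_def)
  then have y1: "-1 \<le> y" "y \<le> 1" by (auto simp: abs_square_le_1 abs_le_iff)
  \<comment> \<open>The exact angle between \<open>b\<close> and \<open>c\<close>; the passage from
    \<open>t'\<close> to \<open>t\<close> comes last, by monotonicity of the cosine.\<close>
  define t' where "t' = arccos y"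
  have t': "0 \<le> t'" "t' \<le> pi" "cos t' = y"
    using y1 by (auto simp: t'_def arccos_lbound arccos_ubound)
  have "t' \<le> t"
    using bc st t' cos_monotone_0_pi[of t t'] unfolding y_def[symmetric] by linarith
  have "(\<Sum>i\<in>I. (a i - cos s * b i) * (c i - y * b i)) = z - cos s * y"
  proof -
    have "(\<Sum>i\<in>I. (a i - cos s * b i) * (c i - y * b i))
      = (\<Sum>i\<in>I. a i * c i) - cos s * (\<Sum>i\<in>I. b i * c i)
        - y * (\<Sum>i\<in>I. a i * b i) + cos s * y * (\<Sum>i\<in>I. (b i)\<^sup>2)"
      unfolding sum_distrib_left sum.distrib[symmetric] sum_subtractf[symmetric]
      by (intro sum.cong) (auto simp: algebra_simps power2_eq_square)
    then show ?thesis using assms by (simp add: z_def y_def)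
  qed
  moreover have "(\<Sum>i\<in>I. (a i - cos s * b i)\<^sup>2) = (sin s)\<^sup>2"
  proof -
    have "(\<Sum>i\<in>I. (a i - cos s * b i)\<^sup>2)
      = (\<Sum>i\<in>I. (a i)\<^sup>2) - 2 * cos s * (\<Sum>i\<in>I. a i * b i) + (cos s)\<^sup>2 * (\<Sum>i\<in>I. (b i)\<^sup>2)"
      unfolding sum_distrib_left sum.distrib[symmetric] sum_subtractf[symmetric]
      by (intro sum.cong) (auto simp: algebra_simps power2_eq_square)
    then show ?thesis unfolding sin_squared_eq using assms by (simp add: power2_eq_square)
  qed
  moreover have "(\<Sum>i\<in>I. (c i - y * b i)\<^sup>2) = (sin t')\<^sup>2"
  proof -
    have "(\<Sum>i\<in>I. (c i - y * b i)\<^sup>2)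
      = (\<Sum>i\<in>I. (c i)\<^sup>2) - 2 * y * (\<Sum>i\<in>I. b i * c i) + y\<^sup>2 * (\<Sum>i\<in>I. (b i)\<^sup>2)"
      unfolding sum_distrib_left sum.distrib[symmetric] sum_subtractf[symmetric]
      by (intro sum.cong) (auto simp: algebra_simps power2_eq_square)
    then show ?thesis
      unfolding sin_squared_eq t'(3) using assms by (simp add: power2_eq_square flip: y_def)
  qed
  ultimately have "(z - cos s * y)\<^sup>2 \<le> (sin s * sin t')\<^sup>2"
    using Cauchy_Schwarz_ineq_sum[of "\<lambda>i. a i - cos s * b i" "\<lambda>i. c i - y * b i" I]
    by (simp add: power_mult_distrib)
  moreover have "0 \<le> sin s * sin t'"
    using st t' by (intro mult_nonneg_nonneg sin_ge_zero) auto
  ultimately have "\<bar>z - cos s * y\<bar> \<le> sin s * sin t'"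
    using abs_le_square_iff[of "z - cos s * y" "sin s * sin t'"] by simp
  then have "cos (s + t') \<le> z" using t' by (simp add: cos_add abs_le_iff)
  moreover have "cos (s + t) \<le> cos (s + t')"
    using \<open>t' \<le> t\<close> st t' by (intro cos_monotone_0_pi_le) auto
  ultimately show ?thesis by (simp add: z_def)
qed

context wf_digraph
begin

text \<open>
  If the vectors attached to adjacent vertices meet at the angle \<open>pi - t\<close>, then negating every
  second vector along a walk turns all consecutive angles into \<open>t\<close>.
\<close>
lemma cos_length_le_inner_walk:
  fixes P :: "'a \<Rightarrow> 'i \<Rightarrow> real"
  assumes unit: "\<And>x. x \<in> verts G \<Longrightarrow> (\<Sum>i\<in>I. (P x i)\<^sup>2) = 1"
    and adj: "\<And>x y. x \<rightarrow>\<^bsub>G\<^esub> y \<Longrightarrow> (\<Sum>i\<in>I. P x i * P y i) = - cos t"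
    and "awalk u p v" "0 \<le> t" "real (length p) * t \<le> pi"
  shows "cos (real (length p) * t) \<le> (-1) ^ length p * (\<Sum>i\<in>I. P u i * P v i)"
  using assms(3,5)
proof (induction p arbitrary: u)
  case Nil
  then show ?case using unit by (auto simp: awalk_Nil_iff power2_eq_square)
next
  case (Cons e p)
  define w where "w = head G e"
  define \<sigma> :: real where "\<sigma> = (-1) ^ length p"
  have \<sigma>: "\<sigma>\<^sup>2 = 1" by (simp add: \<sigma>_def flip: power_mult)
  from Cons.prems(1) have uw: "u \<rightarrow>\<^bsub>G\<^esub> w" and p: "awalk w p v"
    by (auto simp: awalk_Cons_iff w_def in_arcs_imp_in_arcs_ends)
  have V: "u \<in> verts G" "w \<in> verts G" "v \<in> verts G"
    using adj_in_verts[OF uw] p by auto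
  have len: "t + real (length p) * t = real (length (e # p)) * t" by (simp add: algebra_simps)
  have "real (length p) * t \<le> pi" using Cons.prems(2) len assms(4) by linarith
  from Cons.IH[OF p this]
  have IH: "cos (real (length p) * t) \<le> (\<Sum>i\<in>I. P w i * (\<sigma> * P v i))"
    by (simp add: \<sigma>_def sum_distrib_left mult.left_commute)
  \<comment> \<open>The sign \<sigma> absorbs the negations along the rest of the walk, and
    \<open>- P u\<close> meets \<open>P w\<close> at the angle \<open>t\<close>.\<close>
  have "cos (t + real (length p) * t) \<le> (\<Sum>i\<in>I. - P u i * (\<sigma> * P v i))"
  proof (rule cos_add_le_inner[OF _ _ _ _ IH])
    show "(\<Sum>i\<in>I. (\<sigma> * P v i)\<^sup>2) = 1" using unit V \<sigma> by (simp add: power_mult_distrib)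
    show "(\<Sum>i\<in>I. - P u i * P w i) = cos t" using adj[OF uw] by (simp add: sum_negf)
    show "t + real (length p) * t \<le> pi" using Cons.prems(2) len by simp
  qed (use unit V assms(4) in auto)
  also have "\<dots> = (-1) ^ length (e # p) * (\<Sum>i\<in>I. P u i * P v i)"
    by (simp add: \<sigma>_def sum_distrib_left mult.left_commute mult.assoc)
  finally show ?case unfolding len .
qed

text \<open>With alternating negations an odd closed walk leads from a vector to its negative, a
  total turn of pi, so each of its equal angles is at least \<open>pi / length p\<close>.\<close>

lemma gram_edge_ge:
  fixes P :: "'a \<Rightarrow> 'i \<Rightarrow> real"
  assumes diag: "\<And>x. x \<in> verts G \<Longrightarrow> (\<Sum>i\<in>I. (P x i)\<^sup>2) = \<alpha>"
    and adj: "\<And>x y. x \<rightarrow>\<^bsub>G\<^esub> y \<Longrightarrow> (\<Sum>i\<in>I. P x i * P y i) = \<beta>"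
    and p: "awalk u p u" "odd (length p)"
  shows "- cos (pi / real (length p)) * \<alpha> \<le> \<beta>"
proof -
  from p obtain e q where "p = e # q" by (cases p) auto
  with p have uw: "u \<rightarrow>\<^bsub>G\<^esub> head G e" by (auto simp: awalk_Cons_iff in_arcs_imp_in_arcs_ends)
  have V: "u \<in> verts G" "head G e \<in> verts G" using adj_in_verts[OF uw] by auto
  have cs: "\<beta>\<^sup>2 \<le> \<alpha>\<^sup>2"
    using Cauchy_Schwarz_ineq_sum[of "P u" "P (head G e)" I] diag V adj[OF uw]
    by (simp add: power2_eq_square)
  have "0 \<le> \<alpha>" using diag[OF V(1)] by (auto intro: sum_nonneg)
  show ?thesis
  proof (cases "\<alpha> = 0")
    \<comment> \<open>Zero vectors cannot be normalised, but Cauchy-Schwarz on an edge then forces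
      \<open>\<beta> = 0\<close>.\<close>
    case True
    with cs show ?thesis by simp
  next
    case False
    with \<open>0 \<le> \<alpha>\<close> have "0 < \<alpha>" by simp
    define t where "t = arccos (- \<beta> / \<alpha>)"
    have "\<bar>\<beta>\<bar> \<le> \<alpha>" using cs \<open>0 < \<alpha>\<close> abs_le_square_iff[of \<beta> \<alpha>] by simp
    then have b: "-1 \<le> - \<beta> / \<alpha>" "- \<beta> / \<alpha> \<le> 1" using \<open>0 < \<alpha>\<close> by (auto simp: field_simps)
    have t: "0 \<le> t" "t \<le> pi" "cos t = - \<beta> / \<alpha>"
      using b by (auto simp: t_def arccos_lbound arccos_ubound)
    define Q where "Q x i = P x i / sqrt \<alpha>" for x i
    have unit: "(\<Sum>i\<in>I. (Q x i)\<^sup>2) = 1" if "x \<in> verts G" for x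
      using diag[OF that] \<open>0 < \<alpha>\<close> by (simp add: Q_def power_divide flip: sum_divide_distrib)
    have adjQ: "(\<Sum>i\<in>I. Q x i * Q y i) = - cos t" if "x \<rightarrow>\<^bsub>G\<^esub> y" for x y
      using adj[OF that] \<open>0 < \<alpha>\<close> t by (simp add: Q_def flip: sum_divide_distrib)
    have len: "0 < real (length p)" using p(2) by (auto intro: Nat.gr0I)
    \<comment> \<open>Otherwise the walk estimate with both ends at \<open>u\<close> would give a
      cosine of at most -1 at an angle below pi.\<close>
    have "pi \<le> real (length p) * t"
    proof (rule ccontr)
      assume "\<not> ?thesis"
      then have lt: "real (length p) * t < pi" by simp
      then have "cos (real (length p) * t) \<le> (-1) ^ length p * (\<Sum>i\<in>I. Q u i * Q u i)"
        by (intro cos_length_le_inner_walk unit adjQ p t) auto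
      also have "\<dots> = -1" using p(2) unit[OF V(1)] by (simp add: power2_eq_square)
      finally have "cos (real (length p) * t) \<le> cos pi" by simp
      moreover have "cos pi < cos (real (length p) * t)"
        using lt t len by (intro cos_monotone_0_pi) auto
      ultimately show False by simp
    qed
    then have "pi / real (length p) \<le> t" using len by (simp add: field_simps)
    then have "cos t \<le> cos (pi / real (length p))"
      using t len by (intro cos_monotone_0_pi_le) auto
    then show ?thesis using t \<open>0 < \<alpha>\<close> by (simp add: field_simps)
  qed
qed

end

section \<open>Powers of a shifted adjacency matrix\<close>

text \<open>The entries of \<open>(r I - A) ^ n\<close>, where \<open>A\<close> is the adjacency matrix.\<close>
primrec shift_power :: "('a, 'b) pre_digraph \<Rightarrow> real \<Rightarrow> nat \<Rightarrow> 'a \<Rightarrow> 'a \<Rightarrow> real" where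
  "shift_power G r 0 x y = (if x = y then 1 else 0)"
| "shift_power G r (Suc n) x y
    = r * shift_power G r n x y - (\<Sum>w\<in>nbrs G y. shift_power G r n x w)"

context graph
begin

lemma finite_nbrs [simp]: "finite (nbrs G v)"
  by (simp add: nbrs_def)

lemma nbrs_iff: "w \<in> nbrs G v \<longleftrightarrow> v \<rightarrow>\<^bsub>G\<^esub> w"
  using adj_in_verts by (auto simp: nbrs_def)

lemma nbrs_sum_eq: "(\<Sum>w\<in>nbrs G v. F w) = (\<Sum>w\<in>verts G. if v \<rightarrow>\<^bsub>G\<^esub> w then F w else (0 :: real))"
  by (simp add: nbrs_def sum.inter_filter)

text \<open>Self-adjointness of the adjacency operator, from the symmetry of adjacency.\<close>

lemma nbrs_sum_swap:
  fixes F H :: "'a \<Rightarrow> real"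
  shows "(\<Sum>z\<in>verts G. F z * (\<Sum>w\<in>nbrs G z. H w)) = (\<Sum>w\<in>verts G. (\<Sum>z\<in>nbrs G w. F z) * H w)"
proof -
  have "(\<Sum>z\<in>verts G. F z * (\<Sum>w\<in>nbrs G z. H w))
      = (\<Sum>z\<in>verts G. \<Sum>w\<in>verts G. if z \<rightarrow>\<^bsub>G\<^esub> w then F z * H w else 0)"
    unfolding nbrs_sum_eq sum_distrib_left by (intro sum.cong) auto
  also have "\<dots> = (\<Sum>w\<in>verts G. \<Sum>z\<in>verts G. if z \<rightarrow>\<^bsub>G\<^esub> w then F z * H w else 0)"
    by (rule sum.swap)
  also have "\<dots> = (\<Sum>w\<in>verts G. (\<Sum>z\<in>nbrs G w. F z) * H w)"
    unfolding nbrs_sum_eq sum_distrib_right using adj_sym by (intro sum.cong) auto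
  finally show ?thesis .
qed

lemma card_nbrs: "card (nbrs G v) = out_degree G v"
proof -
  have "nbrs G v = head G ` out_arcs G v"
    by (auto simp: nbrs_iff arcs_ends_conv out_arcs_def)
  moreover have "inj_on (head G) (out_arcs G v)"
    using no_multi_arcs by (auto simp: inj_on_def out_arcs_def arc_to_ends_def)
  ultimately show ?thesis by (simp add: out_degree_def card_image)
qed

lemma shift_power_add:
  assumes "y \<in> verts G"
  shows "(\<Sum>z\<in>verts G. shift_power G r m x z * shift_power G r n z y) = shift_power G r (m + n) x y"
  using assms
proof (induction n arbitrary: y)
  case 0
  have "(\<Sum>z\<in>verts G. shift_power G r m x z * shift_power G r 0 z y)
    = (\<Sum>z\<in>verts G. if z = y then shift_power G r m x z else 0)"
    by (intro sum.cong) auto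
  then show ?case using 0 by simp
next
  case (Suc n)
  have "(\<Sum>z\<in>verts G. shift_power G r m x z * shift_power G r (Suc n) z y)
    = r * (\<Sum>z\<in>verts G. shift_power G r m x z * shift_power G r n z y)
      - (\<Sum>z\<in>verts G. \<Sum>w\<in>nbrs G y. shift_power G r m x z * shift_power G r n z w)"
    by (simp add: algebra_simps sum_subtractf sum_distrib_left)
  also have "(\<Sum>z\<in>verts G. \<Sum>w\<in>nbrs G y. shift_power G r m x z * shift_power G r n z w)
    = (\<Sum>w\<in>nbrs G y. \<Sum>z\<in>verts G. shift_power G r m x z * shift_power G r n z w)"
    by (rule sum.swap)
  also have "\<dots> = (\<Sum>w\<in>nbrs G y. shift_power G r (m + n) x w)"
    by (intro sum.cong Suc.IH) (auto simp: nbrs_def)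
  finally show ?case using Suc by simp
qed

text \<open>On \<open>f\<close> the matrix \<open>r I - A\<close> acts as the scalar
  \<open>r - \<theta>\<close>. The recursion multiplies by it on the right, and self-adjointness
  moves \<open>A\<close> over to \<open>f\<close>.\<close>

lemma shift_power_eigenfunction:
  assumes f: "\<And>v. v \<in> verts G \<Longrightarrow> (\<Sum>w\<in>nbrs G v. f w) = \<theta> * f v" and "x \<in> verts G"
  shows "(\<Sum>z\<in>verts G. shift_power G r n x z * f z) = (r - \<theta>) ^ n * f x"
proof (induction n)
  case 0
  have "(\<Sum>z\<in>verts G. shift_power G r 0 x z * f z) = (\<Sum>z\<in>verts G. if x = z then f z else 0)"
    by (intro sum.cong) auto
  then show ?case using assms(2) by simp
next
  case (Suc n)
  have "(\<Sum>z\<in>verts G. shift_power G r (Suc n) x z * f z)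
    = r * (\<Sum>z\<in>verts G. shift_power G r n x z * f z)
      - (\<Sum>z\<in>verts G. (\<Sum>w\<in>nbrs G z. shift_power G r n x w) * f z)"
    by (simp add: algebra_simps sum_subtractf sum_distrib_left)
  also have "(\<Sum>z\<in>verts G. (\<Sum>w\<in>nbrs G z. shift_power G r n x w) * f z)
    = (\<Sum>z\<in>verts G. shift_power G r n x z * (\<theta> * f z))"
    unfolding nbrs_sum_swap[symmetric] by (intro sum.cong) (auto simp: f)
  also have "\<dots> = \<theta> * (\<Sum>z\<in>verts G. shift_power G r n x z * f z)"
    by (simp add: sum_distrib_left mult.left_commute)
  finally show ?case unfolding Suc by (simp add: algebra_simps del: shift_power.simps)
qed

end

text \<open>Compares growth rates despite a constant factor: for \<open>b < a\<close> the sequence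
  \<open>C * (b / a) ^ n\<close> would tend to 0 while staying at least 1.\<close>

lemma le_if_powers_le_mult:
  fixes a b C :: real
  assumes "0 < a" "0 \<le> b" and le: "\<And>n. a ^ n \<le> C * b ^ n"
  shows "a \<le> b"
proof (rule ccontr)
  assume "\<not> a \<le> b"
  then have "(\<lambda>n. C * (b / a) ^ n) \<longlonglongrightarrow> C * 0"
    using assms(1,2) by (intro tendsto_mult tendsto_const LIMSEQ_power_zero) auto
  moreover have "1 \<le> C * (b / a) ^ n" for n
    using le[of n] assms(1) by (simp add: field_simps)
  ultimately have "(1 :: real) \<le> C * 0" by (intro LIMSEQ_le_const) auto
  then show False by simp
qed

section \<open>Distance-regular graphs\<close>

text \<open>The intersection array in terms of natural-number distances. In \<open>card_c\<close>
  the \<open>+ 1\<close> on the side of \<open>w\<close> avoids truncated subtraction, so the set is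
  empty at distance 0.\<close>

locale distance_regular_graph = connected_graph +
  fixes k :: nat and b c :: "nat \<Rightarrow> nat"
  assumes deg: "v \<in> verts G \<Longrightarrow> card (nbrs G v) = k"
    and card_b: "\<lbrakk>u \<in> verts G; v \<in> verts G\<rbrakk> \<Longrightarrow>
      card {w \<in> nbrs G v. hop_dist G u w = hop_dist G u v + 1} = b (hop_dist G u v)"
    and card_c: "\<lbrakk>u \<in> verts G; v \<in> verts G\<rbrakk> \<Longrightarrow>
      card {w \<in> nbrs G v. hop_dist G u w + 1 = hop_dist G u v} = c (hop_dist G u v)"
begin

text \<open>The three-term recurrence by which \<open>A\<close> acts on functions of the distance;
  the last coefficient counts the neighbours at unchanged distance.\<close>

lemma nbrs_sum_hop_dist:
  fixes \<kappa> :: "nat \<Rightarrow> real"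
  assumes u: "u \<in> verts G" and v: "v \<in> verts G" and i: "hop_dist G u v = i"
  shows "(\<Sum>w\<in>nbrs G v. \<kappa> (hop_dist G u w))
    = real (b i) * \<kappa> (i + 1) + real (c i) * \<kappa> (i - 1) + (real k - real (b i) - real (c i)) * \<kappa> i"
proof -
  define B where "B = {w \<in> nbrs G v. hop_dist G u w = i + 1}"
  define C where "C = {w \<in> nbrs G v. hop_dist G u w + 1 = i}"
  define A where "A = {w \<in> nbrs G v. hop_dist G u w = i}"
  have "hop_dist G u w = i + 1 \<or> hop_dist G u w = i \<or> hop_dist G u w + 1 = i"
    if "w \<in> nbrs G v" for w
    using hop_dist_nbr_cases[OF u, of v w] that i by (auto simp: nbrs_iff)
  then have N: "nbrs G v = B \<union> C \<union> A" unfolding A_def B_def C_def by blast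
  have disj: "B \<inter> C = {}" "(B \<union> C) \<inter> A = {}" by (auto simp: A_def B_def C_def)
  have fin: "finite A" "finite B" "finite C" by (auto simp: A_def B_def C_def)
  have split: "(\<Sum>w\<in>nbrs G v. F w) = (\<Sum>w\<in>B. F w) + (\<Sum>w\<in>C. F w) + (\<Sum>w\<in>A. F w)"
    for F :: "'a \<Rightarrow> real"
    unfolding N using disj fin by (simp add: sum.union_disjoint)
  have card: "card B = b i" "card C = c i"
    using card_b[OF u v] card_c[OF u v] i by (auto simp: B_def C_def)
  have cardA: "real (card A) = real k - real (b i) - real (c i)"
    using split[of "\<lambda>_. 1"] deg[OF v] card by simp
  have "(\<Sum>w\<in>B. \<kappa> (hop_dist G u w)) = (\<Sum>w\<in>B. \<kappa> (i + 1))"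
    by (intro sum.cong refl arg_cong[of _ _ \<kappa>]) (simp add: B_def)
  \<comment> \<open>For \<open>i = 0\<close> the truncated index \<open>i - 1\<close> does no harm,
    since \<open>C\<close> is then empty and \<open>c 0 = 0\<close>.\<close>
  moreover have "(\<Sum>w\<in>C. \<kappa> (hop_dist G u w)) = (\<Sum>w\<in>C. \<kappa> (i - 1))"
    by (intro sum.cong refl arg_cong[of _ _ \<kappa>]) (auto simp: C_def)
  moreover have "(\<Sum>w\<in>A. \<kappa> (hop_dist G u w)) = (\<Sum>w\<in>A. \<kappa> i)"
    by (intro sum.cong refl arg_cong[of _ _ \<kappa>]) (simp add: A_def)
  ultimately show ?thesis unfolding split using card cardA by simp
qed

text \<open>The identity matrix depends only on the distance, and by the three-term recurrence
  multiplication by \<open>r I - A\<close> preserves this.\<close>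

lemma shift_power_hop_dist:
  "\<exists>\<kappa>. \<forall>u\<in>verts G. \<forall>v\<in>verts G. shift_power G r n u v = \<kappa> (hop_dist G u v)"
proof (induction n)
  case 0
  have "hop_dist G u v = 0 \<longleftrightarrow> u = v" if uv: "u \<in> verts G" "v \<in> verts G" for u v
    using hop_dist_awalk[OF uv] hop_dist_self[OF uv(1)] by (auto simp: awalk_Nil_iff)
  then show ?case by (intro exI[of _ "\<lambda>i. if i = 0 then 1 else 0"]) auto
next
  case (Suc n)
  then obtain \<kappa> where \<kappa>: "\<And>u v. \<lbrakk>u \<in> verts G; v \<in> verts G\<rbrakk> \<Longrightarrow>
      shift_power G r n u v = \<kappa> (hop_dist G u v)" by blast
  define \<kappa>' where "\<kappa>' i = r * \<kappa> i - (real (b i) * \<kappa> (i + 1) + real (c i) * \<kappa> (i - 1)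
      + (real k - real (b i) - real (c i)) * \<kappa> i)" for i
  have "shift_power G r (Suc n) u v = \<kappa>' (hop_dist G u v)"
    if uv: "u \<in> verts G" "v \<in> verts G" for u v
  proof -
    have "(\<Sum>w\<in>nbrs G v. shift_power G r n u w) = (\<Sum>w\<in>nbrs G v. \<kappa> (hop_dist G u w))"
      using \<kappa> uv by (intro sum.cong) (auto simp: nbrs_def)
    then show ?thesis using \<kappa> uv nbrs_sum_hop_dist[OF uv refl] by (simp add: \<kappa>'_def)
  qed
  then show ?case by blast
qed

section \<open>Gram structure of the even powers\<close>

lemma shift_power_cong:
  assumes "u \<in> verts G" "v \<in> verts G" "x \<in> verts G" "y \<in> verts G"
    "hop_dist G u v = hop_dist G x y"
  shows "shift_power G r n u v = shift_power G r n x y"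
  using shift_power_hop_dist assms by metis

text \<open>Dependence on the distance alone makes the powers symmetric, which turns
  \<open>shift_power_add\<close> into a Gram identity.\<close>

lemma shift_power_gram:
  assumes "x \<in> verts G" "y \<in> verts G"
  shows "(\<Sum>z\<in>verts G. shift_power G r n x z * shift_power G r n y z) = shift_power G r (2 * n) x y"
proof -
  have "shift_power G r n y z = shift_power G r n z y" if "z \<in> verts G" for z
    using assms that hop_dist_commute by (intro shift_power_cong) auto
  then show ?thesis
    unfolding mult_2 shift_power_add[OF assms(2), symmetric] by (intro sum.cong) auto
qed

text \<open>The rows of the \<open>n\<close>-th power all have the same norm, so Cauchy-Schwarz
  bounds every inner product by the common diagonal entry.\<close>

lemma abs_shift_power_le_diag:
  assumes "x \<in> verts G" "y \<in> verts G"
  shows "\<bar>shift_power G r (2 * n) x y\<bar> \<le> shift_power G r (2 * n) x x"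
proof -
  have diag: "(\<Sum>z\<in>verts G. (shift_power G r n v z)\<^sup>2) = shift_power G r (2 * n) x x"
    if "v \<in> verts G" for v
  proof -
    have "shift_power G r (2 * n) v v = shift_power G r (2 * n) x x"
      using that assms hop_dist_self by (intro shift_power_cong) auto
    then show ?thesis using shift_power_gram[OF that that] by (simp add: power2_eq_square)
  qed
  have "0 \<le> shift_power G r (2 * n) x x"
    unfolding diag[OF assms(1), symmetric] by (intro sum_nonneg) auto
  moreover have "(shift_power G r (2 * n) x y)\<^sup>2 \<le> (shift_power G r (2 * n) x x)\<^sup>2"
    using Cauchy_Schwarz_ineq_sum[of "shift_power G r n x" "shift_power G r n y" "verts G"]
    unfolding diag[OF assms(1)] diag[OF assms(2)] shift_power_gram[OF assms]
    by (simp add: power2_eq_square)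
  ultimately show ?thesis by (simp add: abs_le_square_iff[symmetric])
qed

lemma shift_power_diag_nonneg:
  "x \<in> verts G \<Longrightarrow> 0 \<le> shift_power G r (2 * n) x x"
  using abs_shift_power_le_diag[of x x r n] by (rule order_trans[OF abs_ge_zero])

text \<open>Each step multiplies by \<open>r^2 I - 2 r A + A^2\<close>. The angle bound controls the
  edge entries in the linear term, and the diagonal entry bounds those in the quadratic
  term.\<close>

lemma shift_power_diag_le:
  assumes p: "awalk u p u" "odd (length p)" and r: "0 \<le> r" and x: "x \<in> verts G"
  defines "Q \<equiv> r\<^sup>2 + 2 * r * (real k * cos (pi / real (length p))) + (real k)\<^sup>2"
  shows "shift_power G r (2 * n) x x \<le> Q ^ n"
proof (induction n)
  case 0
  then show ?case by simp
next
  case (Suc n)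
  define \<alpha> where "\<alpha> = shift_power G r (2 * n) x x"
  define \<gamma> where "\<gamma> = cos (pi / real (length p))"
  have "0 \<le> \<alpha>" using shift_power_diag_nonneg[OF x] by (simp add: \<alpha>_def)
  \<comment> \<open>All edges lie at distance 1 and share one entry, so the rows of the
    \<open>n\<close>-th power meet the hypotheses of \<open>gram_edge_ge\<close> along
    \<open>p\<close>.\<close>
  have edge: "- \<gamma> * \<alpha> \<le> shift_power G r (2 * n) x w" if xw: "x \<rightarrow>\<^bsub>G\<^esub> w" for w
    unfolding \<gamma>_def
  proof (rule gram_edge_ge[where I = "verts G" and P = "shift_power G r n", OF _ _ p])
    fix v assume v: "v \<in> verts G"
    have "shift_power G r (2 * n) v v = \<alpha>"
      unfolding \<alpha>_def using v x hop_dist_self by (intro shift_power_cong) auto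
    then show "(\<Sum>z\<in>verts G. (shift_power G r n v z)\<^sup>2) = \<alpha>"
      using shift_power_gram[OF v v] by (simp add: power2_eq_square)
  next
    fix v y assume vy: "v \<rightarrow>\<^bsub>G\<^esub> y"
    have "v \<in> verts G" "y \<in> verts G" "w \<in> verts G" using adj_in_verts vy xw by auto
    then show "(\<Sum>z\<in>verts G. shift_power G r n v z * shift_power G r n y z)
        = shift_power G r (2 * n) x w"
      unfolding shift_power_gram[OF \<open>v \<in> verts G\<close> \<open>y \<in> verts G\<close>]
      using x vy xw by (intro shift_power_cong) (auto simp: hop_dist_adj)
  qed
  have "shift_power G r (2 * Suc n) x x = r\<^sup>2 * \<alpha> - 2 * r * (\<Sum>w\<in>nbrs G x. shift_power G r (2 * n) x w)
      + (\<Sum>w\<in>nbrs G x. \<Sum>v\<in>nbrs G w. shift_power G r (2 * n) x v)"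
    by (simp add: \<alpha>_def algebra_simps power2_eq_square sum_subtractf sum_distrib_left)
  also have "\<dots> \<le> r\<^sup>2 * \<alpha> - 2 * r * (real k * (- \<gamma> * \<alpha>)) + real k * (real k * \<alpha>)"
  proof (intro add_mono diff_mono mult_left_mono order_refl)
    have "real (card (nbrs G x)) * (- \<gamma> * \<alpha>) \<le> (\<Sum>w\<in>nbrs G x. shift_power G r (2 * n) x w)"
      using edge by (intro sum_bounded_below) (auto simp: nbrs_iff)
    then show "real k * (- \<gamma> * \<alpha>) \<le> (\<Sum>w\<in>nbrs G x. shift_power G r (2 * n) x w)"
      using deg[OF x] by simp
    have "(\<Sum>v\<in>nbrs G w. shift_power G r (2 * n) x v) \<le> real k * \<alpha>" if w: "w \<in> nbrs G x" for w
    proof -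
      have "(\<Sum>v\<in>nbrs G w. shift_power G r (2 * n) x v) \<le> real (card (nbrs G w)) * \<alpha>"
        unfolding \<alpha>_def using abs_shift_power_le_diag[OF x]
        by (intro sum_bounded_above) (auto simp: nbrs_def abs_le_iff)
      then show ?thesis using deg w by (auto simp: nbrs_def)
    qed
    then have "(\<Sum>w\<in>nbrs G x. \<Sum>v\<in>nbrs G w. shift_power G r (2 * n) x v)
        \<le> real (card (nbrs G x)) * (real k * \<alpha>)"
      by (intro sum_bounded_above) auto
    then show "(\<Sum>w\<in>nbrs G x. \<Sum>v\<in>nbrs G w. shift_power G r (2 * n) x v) \<le> real k * (real k * \<alpha>)"
      using deg[OF x] by simp
  qed (use r in auto)
  also have "\<dots> = Q * \<alpha>" by (simp add: Q_def \<gamma>_def algebra_simps power2_eq_square)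
  \<comment> \<open>Multiplying the induction hypothesis by \<open>Q\<close> is sound because
    \<open>Q = (r - k)^2 + 2 r k (1 + \<gamma>)\<close> is nonnegative.\<close>
  also have "\<dots> \<le> Q * Q ^ n"
  proof (intro mult_left_mono)
    have "0 \<le> 1 + \<gamma>"
      unfolding \<gamma>_def using cos_ge_minus_one[of "pi / real (length p)"] by linarith
    then have "0 \<le> 2 * r * (real k * (1 + \<gamma>))" using r by (intro mult_nonneg_nonneg) auto
    then have "0 \<le> (r - real k)\<^sup>2 + 2 * r * (real k * (1 + \<gamma>))" by (intro add_nonneg_nonneg) auto
    then show "0 \<le> Q" by (simp add: Q_def \<gamma>_def power2_eq_square algebra_simps)
  qed (use Suc in \<open>simp add: \<alpha>_def\<close>)
  finally show ?case by simp
qed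

text \<open>
  Comparing growth rates gives \<open>(r - \<theta>)\<^sup>2 \<le> r\<^sup>2 + 2 r k cos (pi / g) + k\<^sup>2\<close> for all \<open>r\<close>;
  the terms linear in \<open>r\<close> give the bound.
\<close>
lemma eigenvalue_ge:
  assumes p: "awalk u p u" "odd (length p)"
    and f: "\<And>v. v \<in> verts G \<Longrightarrow> (\<Sum>w\<in>nbrs G v. f w) = \<theta> * f v"
    and x: "x \<in> verts G" "f x \<noteq> 0"
  shows "- (real k * cos (pi / real (length p))) \<le> \<theta>"
proof -
  define \<gamma> where "\<gamma> = real k * cos (pi / real (length p))"
  have quad: "(r - \<theta>)\<^sup>2 \<le> r\<^sup>2 + 2 * r * \<gamma> + (real k)\<^sup>2" (is "_ \<le> ?Q") if r: "0 \<le> r" for r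
  proof (cases "r = \<theta>")
    \<comment> \<open>The growth comparison needs a positive base. Here the left side vanishes, and
      the right side dominates a nonnegative diagonal entry.\<close>
    case True
    show ?thesis
      using shift_power_diag_nonneg[OF x(1), of r 1] shift_power_diag_le[OF p r x(1), of 1] True
      by (simp add: \<gamma>_def)
  next
    case False
    have Q: "shift_power G r (2 * n) x x \<le> ?Q ^ n" for n
      using shift_power_diag_le[OF p r x(1)] by (simp add: \<gamma>_def)
    \<comment> \<open>The constant comes from pairing row \<open>x\<close> with \<open>f\<close>:
      each entry is at most \<open>?Q ^ n\<close> in absolute value, and the eigenvalue equation at
      \<open>x\<close> is divided by \<open>\<bar>f x\<bar>\<close>.\<close>
    have pow: "((r - \<theta>)\<^sup>2) ^ n \<le> ((\<Sum>z\<in>verts G. \<bar>f z\<bar>) / \<bar>f x\<bar>) * ?Q ^ n" for n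
    proof -
      have "((r - \<theta>)\<^sup>2) ^ n * \<bar>f x\<bar> = \<bar>\<Sum>z\<in>verts G. shift_power G r (2 * n) x z * f z\<bar>"
        by (subst shift_power_eigenfunction[where f = f and \<theta> = \<theta>, OF f x(1)])
          (auto simp: abs_mult power_mult)
      also have "\<dots> \<le> (\<Sum>z\<in>verts G. ?Q ^ n * \<bar>f z\<bar>)"
        using order_trans[OF abs_shift_power_le_diag[OF x(1)] Q]
        by (intro sum_abs[THEN order_trans] sum_mono) (simp add: abs_mult mult_right_mono)
      finally show ?thesis
        using x(2) unfolding sum_distrib_left[symmetric] by (simp add: field_simps)
    qed
    have "0 < (r - \<theta>)\<^sup>2" using False by simp
    moreover have "0 \<le> ?Q"
      using shift_power_diag_nonneg[OF x(1), of r 1] Q[of 1] by simp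
    ultimately show ?thesis by (rule le_if_powers_le_mult[OF _ _ pow])
  qed
  show ?thesis
  proof (rule ccontr)
    assume "\<not> ?thesis"
    then have d: "0 < - \<theta> - \<gamma>" by (simp add: \<gamma>_def)
    \<comment> \<open>Chosen so that \<open>r * (- \<theta> - \<gamma>)\<close> exceeds
      \<open>k^2\<close>, whereas expanding \<open>quad\<close> bounds twice this product by
      \<open>k^2 - \<theta>^2\<close>.\<close>
    define r where "r = (real k)\<^sup>2 / (- \<theta> - \<gamma>) + 1"
    have "0 \<le> r" using d by (simp add: r_def)
    have eq: "r * (- \<theta> - \<gamma>) = (real k)\<^sup>2 + (- \<theta> - \<gamma>)" using d by (simp add: r_def field_simps)
    have "2 * (r * (- \<theta> - \<gamma>)) \<le> (real k)\<^sup>2 - \<theta>\<^sup>2"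
      using quad[OF \<open>0 \<le> r\<close>] by (simp add: power2_eq_square algebra_simps)
    then show False
      unfolding eq using d zero_le_power2[of "real k"] zero_le_power2[of \<theta>] by argo
  qed
qed

end

section \<open>The bound on \<open>\<delta>\<close>\<close>

lemma (in graph) graph_eigenvalues_iff:
  "x \<in> graph_eigenvalues G \<longleftrightarrow>
    (\<exists>f. (\<exists>v\<in>verts G. f v \<noteq> 0) \<and> (\<forall>v\<in>verts G. (\<Sum>w\<in>nbrs G v. f w) = x * f v))"
proof -
  obtain vs where vs: "distinct vs" "set vs = verts G"
    using finite_distinct_list[OF finite_verts] by blast
  show ?thesis
    unfolding graph_eigenvalues_eq_spectrum[OF vs] spectrum_def mem_Collect_eq
      eigenvalue_adjacency_matrix_iff[OF vs] nbrs_sum_eq ..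
qed

text \<open>Gives \<open>Min\<close> and \<open>Max\<close> in \<open>lambda_min\<close> and
  \<open>lambda_max\<close> their intended meaning.\<close>

lemma (in graph) finite_graph_eigenvalues: "finite (graph_eigenvalues G)"
proof -
  obtain vs where vs: "distinct vs" "set vs = verts G"
    using finite_distinct_list[OF finite_verts] by blast
  have "adjacency_matrix G vs \<in> carrier_mat (length vs) (length vs)"
    by (simp add: adjacency_matrix_def)
  then show ?thesis
    unfolding graph_eigenvalues_eq_spectrum[OF vs] by (rule card_finite_spectrum)
qed

text \<open>Lagrange form of the fourth-order remainder; strictness holds because the intermediate
  point lies strictly between 0 and pi, where the cosine is below 1.\<close>

lemma cos_less_taylor4:
  fixes x :: real
  assumes "0 < x" "x \<le> pi"
  shows "cos x < 1 - x\<^sup>2 / 2 + x ^ 4 / 24"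
proof -
  obtain t where t: "0 < t" "t < x"
    and eq: "cos x = (\<Sum>m<4. cos_coeff m * x ^ m) + cos (t + 1/2 * real 4 * pi) / fact 4 * x ^ 4"
    using Maclaurin_cos_expansion2[of x 4] assms by auto
  have "cos t < 1" using cos_monotone_0_pi[of 0 t] t assms by simp
  then have "cos t * x ^ 4 < 1 * x ^ 4" using assms by (intro mult_strict_right_mono) auto
  moreover have "{..<4 :: nat} = {0, 1, 2, 3}" by auto
  \<comment> \<open>The phase \<open>1/2 * real 4 * pi\<close> in the remainder is a full
    period.\<close>
  then have "cos x = 1 - x\<^sup>2 / 2 + cos t * x ^ 4 / 24"
    unfolding eq by (simp add: cos_coeff_def fact_numeral)
  ultimately show ?thesis by simp
qed

theorem corollary3p2:
  fixes G :: "('a, 'b) pre_digraph" and k h :: nat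
  assumes "graph G"
    and "regular_graph G k"
    and "\<not> bipartite G"
    and "distance_regular G"
    and "odd_girth G = 2 * h + 1"
  shows "graph_delta G \<ge> (1 - cos (pi / real (2 * h + 1))) * real k
    \<and> (1 - cos (pi / real (2 * h + 1))) * real k
        > (pi ^ 2 / (2 * real (2 * h + 1) ^ 2) - pi ^ 4 / (24 * real (2 * h + 1) ^ 4)) * real k"
proof -
  interpret graph G by (rule assms(1))
  interpret connected_graph G
    using assms(4) by unfold_locales (simp add: distance_regular_def)
  obtain b c where bc: "\<forall>i. \<forall>u\<in>verts G. \<forall>v\<in>verts G. graph_dist G u v = ereal (real i) \<longrightarrow>
      card {w \<in> verts G. v \<rightarrow>\<^bsub>G\<^esub> w \<and> graph_dist G u w = ereal (real i + 1)} = b i \<and>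
      card {w \<in> verts G. v \<rightarrow>\<^bsub>G\<^esub> w \<and> graph_dist G u w = ereal (real i - 1)} = c i"
    using assms(4) unfolding distance_regular_def by blast
  interpret distance_regular_graph G k b c
  proof
    fix v assume "v \<in> verts G"
    then show "card (nbrs G v) = k"
      using assms(2) by (simp add: card_nbrs regular_graph_def)
  next
    fix u v assume uv: "u \<in> verts G" "v \<in> verts G"
    have "{w \<in> nbrs G v. hop_dist G u w = hop_dist G u v + 1}
        = {w \<in> verts G. v \<rightarrow>\<^bsub>G\<^esub> w \<and> graph_dist G u w = ereal (real (hop_dist G u v) + 1)}"
      using uv by (auto simp: nbrs_def graph_dist_eq_hop_dist)
    then show "card {w \<in> nbrs G v. hop_dist G u w = hop_dist G u v + 1} = b (hop_dist G u v)"
      using bc uv graph_dist_eq_hop_dist[OF uv] by simp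
    have "{w \<in> nbrs G v. hop_dist G u w + 1 = hop_dist G u v}
        = {w \<in> verts G. v \<rightarrow>\<^bsub>G\<^esub> w \<and> graph_dist G u w = ereal (real (hop_dist G u v) - 1)}"
      using uv by (auto simp: nbrs_def graph_dist_eq_hop_dist)
    then show "card {w \<in> nbrs G v. hop_dist G u w + 1 = hop_dist G u v} = c (hop_dist G u v)"
      using bc uv graph_dist_eq_hop_dist[OF uv] by simp
  qed
  \<comment> \<open>Non-bipartiteness supplies an odd cycle, so the \<open>LEAST\<close> in
    \<open>odd_girth\<close> is attained.\<close>
  obtain p u where p: "awalk u p u" "length p = 2 * h + 1"
  proof -
    have "\<exists>n. odd n \<and> (\<exists>p. cycle p \<and> length p = n)"
      using not_bipartite_imp_odd_cycle[OF assms(3)] by blast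
    from LeastI_ex[OF this] have "\<exists>p. cycle p \<and> length p = odd_girth G"
      unfolding odd_girth_def by blast
    then show ?thesis using that assms(5) unfolding cycle_def by metis
  qed
  then obtain e q where "p = e # q" by (cases p) auto
  with p have uv: "u \<rightarrow>\<^bsub>G\<^esub> head G e" by (auto simp: awalk_Cons_iff in_arcs_imp_in_arcs_ends)
  have u: "u \<in> verts G" using adj_in_verts[OF uv] by simp
  have "head G e \<in> nbrs G u" using uv by (simp add: nbrs_iff)
  \<comment> \<open>The first arc of \<open>p\<close> gives \<open>u\<close> a neighbour; positive
    degree keeps the second inequality strict.\<close>
  then have k: "0 < k" using deg[OF u] card_gt_0_iff finite_nbrs by blast
  define \<gamma> where "\<gamma> = cos (pi / real (2 * h + 1))"
  \<comment> \<open>Constant functions are eigenfunctions of a regular graph. This yields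
    \<open>k \<le> lambda_max G\<close> and a nonempty set for \<open>Min\<close>.\<close>
  have k_mem: "real k \<in> graph_eigenvalues G"
    unfolding graph_eigenvalues_iff using u deg by (intro exI[of _ "\<lambda>_. 1"]) auto
  have ge: "- (real k * \<gamma>) \<le> \<theta>" if "\<theta> \<in> graph_eigenvalues G" for \<theta>
    using that eigenvalue_ge[OF p(1)] p(2) unfolding graph_eigenvalues_iff \<gamma>_def by auto
  have "- (real k * \<gamma>) \<le> lambda_min G"
    unfolding lambda_min_def using k_mem finite_graph_eigenvalues
    by (intro ge Min_in) auto
  moreover have "real k \<le> lambda_max G"
    unfolding lambda_max_def by (intro Max_ge finite_graph_eigenvalues k_mem)
  ultimately have "(1 - \<gamma>) * real k \<le> graph_delta G"
    by (simp add: graph_delta_def algebra_simps)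
  \<comment> \<open>The range of the Taylor bound reaches up to pi, which covers every
    \<open>h\<close>, including 0.\<close>
  moreover have "pi / real (2 * h + 1) \<le> pi"
    by (simp add: divide_le_eq mult_left_mono)
  then have "pi ^ 2 / (2 * real (2 * h + 1) ^ 2) - pi ^ 4 / (24 * real (2 * h + 1) ^ 4) < 1 - \<gamma>"
    using cos_less_taylor4[of "pi / real (2 * h + 1)"]
    by (simp add: \<gamma>_def power_divide mult.commute)
  ultimately show ?thesis using k unfolding \<gamma>_def by simp
qed

end
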